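(* Consider the spatial separable covariance model (SSCM) $\mathbb{X}\mid\mathbf{Y}=1_n\mu^T+\mathbb{F}(AB)^T+\mathbb{E}$, $\mathrm{vec}(\mathbb{E}^T)\sim\mathcal{N}(0_{np},H\otimes\Delta)$, with parameters $\mu\in\mathbb{R}^p$, $A\in\mathbb{R}^{p\times d}$, $B\in\mathbb{R}^{d\times r}$ ($d\le p$) and $\Delta\in\mathbb{R}^{p\times p}$ positive definite, whose log-likelihood is $$ l(\mathbb{X}\mid\mathbf{Y};\mu,A,B,\Delta,H)=-\frac{np}{2}\log(2\pi)-\frac p2\log|H|-\frac n2\log|\Delta|-\frac12\mathrm{tr}\Big(H^{-1/2}(\mathbb{X}-1_n\mu^T-\mathbb{F}B^TA^T)\Delta^{-1}(\mathbb{X}-1_n\mu^T-\mathbb{F}B^TA^T)^TH^{-1/2}\Big).$$ Put $$H^c=I_n-(1_n^TH^{-1}1_n)^{-1}1_n1_n^TH^{-1},\qquad \bar{\mathbb{X}}=H^{-1/2}H^c\mathbb{X},\qquad \bar{\mathbb{F}}=H^{-1/2}H^c\mathbb{F},$$ $$\widehat\Sigma_{\bar X,\bar F}=\tfrac1n\bar{\mathbb{X}}^T\bar{\mathbb{F}},\quad \widehat\Sigma_{\bar F,\bar X}=\widehat\Sigma_{\bar X,\bar F}^T,\quad \widehat\Sigma_{\bar F,\bar F}=\tfrac1n\bar{\mathbb{F}}^T\bar{\mathbb{F}},\quad \widehat C_{LS}=\tfrac1n\widehat\Sigma_{\bar X,\bar F}\widehat\Sigma_{\bar F,\bar F}^{-1},$$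 $$\widehat\Delta_{LS}=\tfrac1n(\bar{\mathbb{X}}-\bar{\mathbb{F}}\widehat C_{LS}^T)^T(\bar{\mathbb{X}}-\bar{\mathbb{F}}\widehat C_{LS}^T),$$ and let $\widehat V_{(d)}=[\widehat V_1,\dots,\widehat V_d]$, where $\widehat V_j$ is the (orthonormal) eigenvector corresponding to the $j$-th largest eigenvalue $\lambda_j^2$ of $$\widehat\Sigma=\widehat\Delta_{LS}^{-1/2}\,\widehat\Sigma_{\bar X,\bar F}\,\widehat\Sigma_{\bar F,\bar F}^{-1}\,\widehat\Sigma_{\bar F,\bar X}\,\widehat\Delta_{LS}^{-1/2}.$$ Then, given the matrix $H$, the maximum likelihood estimators of the parameters of the SSCM model are given by $$\widehat A=\widehat\Delta_{LS}^{-1/2}\widehat V_{(d)},\qquad \widehat B=\widehat V_{(d)}^T\widehat\Delta_{LS}^{1/2}\widehat\Sigma_{\bar X,\bar F}\widehat\Sigma_{\bar F,\bar F}^{-1},$$ $$\widehat\mu=(\mathbb{X}^T-\widehat A\widehat B\mathbb{F}^T)H^{-1}1_n(1_n^TH^{-1}1_n)^{-1},$$ $$\widehat\Delta=\frac1n(\bar{\mathbb{X}}^T-\widehat A\widehat B\bar{\mathbb{F}}^T)(\bar{\mathbb{X}}^T-\widehat A\widehat B\bar{\mathbb{F}}^T)^T.$$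
   Context: The rows of $\mathbb{X}\in\mathbb{R}^{n\times p}$ are the vectors of $p$ continuous predictors observed at spatial locations $s_1,\dots,s_n\in D\subset\mathbb{R}^2$; $\mathbf{Y}=(Y_{s_1},\dots,Y_{s_n})^T\in\mathbb{R}^n$ is the vector of responses; the rows of $\mathbb{F}\in\mathbb{R}^{n\times r}$ are $f_{Y_{s_i}}^T$ for known functions $f_{Y_{s_i}}\in\mathbb{R}^r$ of $Y_{s_i}$. $\mathbb{E}\in\mathbb{R}^{n\times p}$ is the error matrix, with rows of mean zero, normally distributed, independent of the responses, with covariance $\Delta$. $H\in\mathbb{R}^{n\times n}$ is the positive definite matrix with entries $H_{ij}=\rho(d(s_i-s_j))$, where $\rho:\mathbb{R}_0^+\to\mathbb{R}_0^+$ is a function of the distance between locations that controls the spatial association. $1_n$ is the $n$-vector of ones, $I_n$ the $n\times n$ identity, $|M|$ the determinant of $M$, and $M^{1/2}$, $M^{-1/2}$ the symmetric square root of a positive definite matrix $M$ and its inverse. The matrices $\widehat\Sigma_{\bar F,\bar F}$ and $\widehat\Delta_{LS}$ are taken to be invertible, so that the formulas make sense.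
   Formalization: The printed formulas are false and were corrected: Ĉ_LS is taken without the extra factor 1/n (also inside Δ̂_LS), and the exponents of Δ̂_LS are exchanged, so Â = Δ̂_LS^{1/2} V̂_(d) and B̂ = V̂_(d)^T Δ̂_LS^{-1/2} Σ̂_XF Σ̂_FF^{-1}. *)

theory Defs
  imports "HOL-Analysis.Analysis"
begin

definition pos_def_matrix :: "real^'n^'n \<Rightarrow> bool" where
  "pos_def_matrix M \<longleftrightarrow> transpose M = M \<and> (\<forall>x. x \<noteq> 0 \<longrightarrow> 0 < x \<bullet> (M *v x))"

text \<open>
  A positive definite matrix has many symmetric square roots but exactly one that is itself
  positive definite; that one is meant.  Both functions are used at positive definite
  arguments only.
\<close>

definition matrix_sqrt :: "real^'n^'n \<Rightarrow> real^'n^'n" where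
  "matrix_sqrt M = (THE R. pos_def_matrix R \<and> R ** R = M)"

definition matrix_invsqrt :: "real^'n^'n \<Rightarrow> real^'n^'n" where
  "matrix_invsqrt M = matrix_inv (matrix_sqrt M)"

text \<open>
  Eigenvalues are listed in decreasing order with multiplicity, so that \<open>v 0\<close> belongs to the
  largest one; only the indices below \<open>CARD('n)\<close> matter.
\<close>

definition ordered_eigenbasis :: "real^'n^'n \<Rightarrow> (nat \<Rightarrow> real) \<Rightarrow> (nat \<Rightarrow> real^'n) \<Rightarrow> bool" where
  "ordered_eigenbasis M ev v \<longleftrightarrow>
     (\<forall>j<CARD('n). M *v v j = ev j *\<^sub>R v j) \<and>
     (\<forall>i<CARD('n). \<forall>j<CARD('n). v i \<bullet> v j = (if i = j then 1 else 0)) \<and>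
     (\<forall>i j. i \<le> j \<and> j < CARD('n) \<longrightarrow> ev j \<le> ev i)"

text \<open>
  Observations are indexed by \<open>'n\<close>, predictors by \<open>'p\<close>, the functions of the response by \<open>'r\<close>;
  \<open>'d\<close> is the reduced dimension.  The row index comes last in \<open>real^'p^'n\<close>, so this is the type
  of the \<open>n \<times> p\<close> matrices.
\<close>

definition sscm_residual ::
  "real^'p^'n \<Rightarrow> real^'r^'n \<Rightarrow> real^'p \<Rightarrow> real^'d^'p \<Rightarrow> real^'r^'d \<Rightarrow> real^'p^'n" where
  "sscm_residual X F \<mu> A B =
     X - (columnvector (vec 1) :: real^1^'n) ** rowvector \<mu> - F ** transpose B ** transpose A"

definition sscm_loglik ::
  "real^'p^'n \<Rightarrow> real^'r^'n \<Rightarrow> real^'p \<Rightarrow> real^'d^'p \<Rightarrow> real^'r^'d \<Rightarrow> real^'p^'p \<Rightarrow> real^'n^'n \<Rightarrow> real"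
where
  "sscm_loglik X F \<mu> A B \<Delta> H =
     - (real CARD('n) * real CARD('p) / 2) * ln (2 * pi)
     - (real CARD('p) / 2) * ln (det H)
     - (real CARD('n) / 2) * ln (det \<Delta>)
     - (1 / 2) * trace (matrix_invsqrt H ** sscm_residual X F \<mu> A B ** matrix_inv \<Delta>
                         ** transpose (sscm_residual X F \<mu> A B) ** matrix_invsqrt H)"

text \<open>
  Maximum likelihood estimates for given \<open>H\<close>: a point of the parameter space at which the
  log-likelihood attains its maximum.  Such a point is never unique, since only the product
  \<open>A ** B\<close> enters the likelihood.
\<close>

definition sscm_mle ::
  "real^'p^'n \<Rightarrow> real^'r^'n \<Rightarrow> real^'n^'n \<Rightarrow>
   real^'p \<Rightarrow> real^'d^'p \<Rightarrow> real^'r^'d \<Rightarrow> real^'p^'p \<Rightarrow> bool" where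
  "sscm_mle X F H \<mu> A B \<Delta> \<longleftrightarrow>
     pos_def_matrix \<Delta> \<and>
     (\<forall>\<mu>' (A' :: real^'d^'p) (B' :: real^'r^'d) \<Delta>'. pos_def_matrix \<Delta>' \<longrightarrow>
        sscm_loglik X F \<mu>' A' B' \<Delta>' H \<le> sscm_loglik X F \<mu> A B \<Delta> H)"

text \<open>
  The published formulas contain two slips which make the claim false, and which the theorem
  about \<^const>\<open>sscm_mle\<close> corrects.

  \<^item> They have \<open>1/n \<Sigma>_XF \<Sigma>_FF^(-1)\<close> for the least squares coefficient.  The factor \<open>1/n\<close> is
    already contained in both covariance matrices and has to be dropped.  With it, \<open>H = I\<close>,
    \<open>n = 2\<close>, \<open>p = r = d = 1\<close> and \<open>X = F = (1, -1)^T\<close> satisfy all hypotheses, but the estimate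
    of \<open>\<Delta>\<close> is \<open>0\<close>.

  \<^item> They exchange the exponents \<open>1/2\<close> and \<open>-1/2\<close> of \<open>\<Delta>_LS\<close> in the estimates of \<open>A\<close> and \<open>B\<close>.
    For \<open>H = I\<close>, \<open>n = 4\<close>, \<open>p = 2\<close>, \<open>r = d = 1\<close>, \<open>F = (1, 1, -1, -1)^T\<close> and \<open>X\<close> with columns
    \<open>(2, 0, 0, -2)^T\<close> and \<open>(3, -1, -3, 1)^T\<close>, they yield \<open>A ** B = (8/5, 2/5)^T\<close> and an estimate
    of \<open>\<Delta>\<close> with determinant \<open>5.8\<close>.  The maximum is attained for \<open>A ** B = (1, 1)^T\<close>, with
    determinant \<open>4\<close>.
\<close>

end

theory Submission
  imports Defs
begin

text \<open>
  After whitening by \<open>H\<close> and profiling out \<open>\<mu>\<close>, the likelihood depends on \<open>C = A B\<close> and \<open>\<Delta>\<close> only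
  through \<open>ln |\<Delta>| + tr (\<Delta>\<^sup>-\<^sup>1 M(C))\<close> with \<open>M(C) = \<Delta>_LS + (C_LS - C) \<Sigma>_FF (C_LS - C)\<^sup>T\<close>.  For fixed
  \<open>C\<close> it is minimal at \<open>\<Delta> = M(C)\<close>, so \<open>|M(C)|\<close> has to be minimised over the matrices \<open>C\<close> of rank at
  most \<open>d\<close>.  Scaling by \<open>\<Delta>_LS\<close> turns this into a lower bound for \<open>|I + N|\<close>, where the quadratic
  forms of \<open>N \<ge> 0\<close> and \<open>\<Sigma>\<close> agree on a subspace of codimension at most \<open>d\<close>.  Hence the \<open>j\<close>-th
  eigenvalue of \<open>N\<close> dominates the \<open>(j + d)\<close>-th one of \<open>\<Sigma>\<close> (Weyl), and
  \<open>|I + N| \<ge> \<Prod>j>d. (1 + \<lambda>\<^sub>j\<^sup>2)\<close>, with equality when \<open>N\<close> is \<open>\<Sigma>\<close>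
  compressed to the orthogonal complement of its top \<open>d\<close> eigenvectors.
\<close>

section \<open>Matrix preliminaries\<close>

text \<open>As simp rules these would turn \<open>transpose A *v x\<close> into
  \<open>x v* A\<close>, whereas the lemmas below are stated with \<open>*v\<close>
  throughout.\<close>

declare transpose_matrix_vector [simp del] vector_transpose_matrix [simp del]

lemma inner_matrix_vector_mult: "x \<bullet> (A *v y) = (transpose A *v x) \<bullet> y"
  for A :: "real^'n^'m"
  by (metis dot_lmul_matrix transpose_matrix_vector)

lemma
  fixes A :: "real^'n^'n"
  assumes "invertible A"
  shows matrix_inv_right: "A ** matrix_inv A = mat 1"
    and matrix_inv_left: "matrix_inv A ** A = mat 1"
  using someI_ex[OF assms[unfolded invertible_def]] by (auto simp: matrix_inv_def)

lemma matrix_inv_unique: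
  fixes A B :: "real^'n^'n"
  assumes "A ** B = mat 1"
  shows "matrix_inv A = B"
proof -
  have "matrix_inv A ** A = mat 1"
    using assms by (intro matrix_inv_left) (auto simp: invertible_right_inverse)
  then have "matrix_inv A ** (A ** B) = B"
    by (simp add: matrix_mul_assoc)
  then show ?thesis
    by (simp add: assms)
qed

lemma transpose_matrix_inv:
  fixes A :: "real^'n^'n"
  assumes "invertible A"
  shows "transpose (matrix_inv A) = matrix_inv (transpose A)"
  by (metis assms matrix_inv_left matrix_inv_unique matrix_transpose_mul transpose_mat)

lemma transpose_0: "transpose 0 = 0"
  by (simp add: transpose_def vec_eq_iff)

lemma transpose_add: "transpose (A + B) = transpose A + transpose B"
  by (simp add: transpose_def vec_eq_iff)

lemma transpose_diff: "transpose (A - B) = transpose A - transpose B"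
  by (simp add: transpose_def vec_eq_iff)

lemma matrix_diff_ldistrib: "A ** (B - C) = A ** B - A ** C"
  for A :: "'a::comm_ring_1^_^_"
  by (simp add: matrix_matrix_mult_def vec_eq_iff sum_subtractf algebra_simps)

lemma matrix_diff_rdistrib: "(B - C) ** A = B ** A - C ** A"
  for A :: "'a::comm_ring_1^_^_"
  by (simp add: matrix_matrix_mult_def vec_eq_iff sum_subtractf algebra_simps)

lemma matrix_add_rdistrib: "(B + C) ** A = B ** A + C ** A"
  for A :: "'a::comm_ring_1^_^_"
  by (simp add: matrix_matrix_mult_def vec_eq_iff sum.distrib algebra_simps)

lemma scaleR_mult_left: "(k *\<^sub>R A) ** B = k *\<^sub>R (A ** B)" for A :: "real^_^_"
  by (simp add: scalar_matrix_assoc)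

lemma scaleR_mult_right: "A ** (k *\<^sub>R B) = k *\<^sub>R (A ** B)" for A :: "real^_^_"
  by (simp add: matrix_scalar_ac scalar_matrix_assoc)

lemmas matrix_distribs = matrix_add_ldistrib matrix_add_rdistrib matrix_diff_ldistrib
  matrix_diff_rdistrib scaleR_mult_left scaleR_mult_right

lemmas transpose_distribs = transpose_add transpose_diff transpose_scalar matrix_transpose_mul

lemma pos_def_matrixD:
  assumes "pos_def_matrix M"
  shows "transpose M = M" and "invertible M" and "x \<noteq> 0 \<Longrightarrow> 0 < x \<bullet> (M *v x)"
proof -
  show "transpose M = M" "x \<noteq> 0 \<Longrightarrow> 0 < x \<bullet> (M *v x)"
    using assms by (auto simp: pos_def_matrix_def)
  have "M *v x = 0 \<longrightarrow> x = 0" for x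
    using assms by (metis inner_zero_right less_irrefl pos_def_matrix_def)
  then show "invertible M"
    by (simp add: invertible_left_inverse matrix_left_invertible_ker)
qed

lemma pos_def_matrix_congruence:
  fixes M :: "real^'n^'n" and C :: "real^'n^'n"
  assumes "pos_def_matrix M" "invertible C"
  shows "pos_def_matrix (transpose C ** M ** C)"
proof -
  have "0 < x \<bullet> ((transpose C ** M ** C) *v x)" if "x \<noteq> 0" for x
  proof -
    have "C *v x \<noteq> 0"
      using \<open>invertible C\<close> that
      by (metis matrix_inv_left matrix_vector_mul_assoc matrix_vector_mul_lid matrix_vector_mult_0_right)
    moreover have "x \<bullet> ((transpose C ** M ** C) *v x) = (C *v x) \<bullet> (M *v (C *v x))"
      by (simp add: matrix_vector_mul_assoc[symmetric]) (simp add: inner_matrix_vector_mult)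
    ultimately show ?thesis
      using assms(1) by (simp add: pos_def_matrix_def)
  qed
  then show ?thesis
    using assms(1) by (simp add: pos_def_matrix_def transpose_distribs matrix_mul_assoc)
qed

text \<open>The span of \<open>W\<close> has dimension at most \<open>card W\<close>, so it is a
  proper subspace. This drives both the successive construction of eigenvectors and the dimension
  count in the comparison of eigenvalues.\<close>

lemma exists_orthogonal_vector:
  fixes W :: "(real^'n) set"
  assumes "finite W" "card W < CARD('n)"
  shows "\<exists>x. x \<noteq> 0 \<and> (\<forall>w\<in>W. w \<bullet> x = 0)"
proof -
  have "dim W < DIM(real^'n)"
    using dim_le_card'[of W] assms by simp
  then obtain x where "x \<noteq> 0" "\<And>y. y \<in> span W \<Longrightarrow> orthogonal x y"
    by (rule orthogonal_to_subspace_exists) blast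
  then show ?thesis
    by (metis inner_commute orthogonal_def span_base)
qed

section \<open>The spectral theorem for real symmetric matrices\<close>

text \<open>
  On an invariant subspace the maximiser of the Rayleigh quotient is an eigenvector: the residual
  \<open>M u - l u\<close> is itself an admissible direction.
\<close>

lemma Rayleigh_maximiser_eigenvector:
  fixes M :: "real^'n^'n"
  assumes sym: "transpose M = M"
    and sub: "subspace W" and inv: "\<And>x. x \<in> W \<Longrightarrow> M *v x \<in> W"
    and u: "u \<in> W" "u \<bullet> (M *v u) = l * (u \<bullet> u)"
    and max: "\<And>x. x \<in> W \<Longrightarrow> x \<bullet> (M *v x) \<le> l * (x \<bullet> x)"
  shows "M *v u = l *\<^sub>R u"
proof -
  define y where "y = M *v u - l *\<^sub>R u"
  define a where "a = l * (y \<bullet> y) - y \<bullet> (M *v y)"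
  have yW: "y \<in> W"
    unfolding y_def by (intro subspace_diff subspace_mul sub inv u)
  then have a: "0 \<le> a"
    using max by (simp add: a_def)
  \<comment> \<open>Maximality along the line \<open>u + t y\<close>: the terms constant in
    \<open>t\<close> cancel because equality holds at \<open>u\<close>, and the linear coefficient
    is twice \<open>y \<bullet> y\<close>.\<close>
  have key: "2 * t * (y \<bullet> y) \<le> t\<^sup>2 * a" for t
  proof -
    have "u + t *\<^sub>R y \<in> W"
      by (intro subspace_add subspace_mul sub u yW)
    then have "(u + t *\<^sub>R y) \<bullet> (M *v (u + t *\<^sub>R y)) \<le> l * ((u + t *\<^sub>R y) \<bullet> (u + t *\<^sub>R y))"
      by (rule max)
    moreover have "u \<bullet> (M *v y) = y \<bullet> (M *v u)"
      by (metis inner_matrix_vector_mult sym inner_commute)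
    ultimately have "2 * t * (y \<bullet> (M *v u) - l * (y \<bullet> u)) \<le> t\<^sup>2 * a"
      using u(2)
      by (simp add: a_def matrix_vector_right_distrib matrix_vector_mult_scaleR inner_add_left
          inner_add_right inner_commute[of u y] algebra_simps power2_eq_square)
    moreover have "y \<bullet> y = y \<bullet> (M *v u) - l * (y \<bullet> u)"
      by (subst (2) y_def) (simp add: inner_diff_right)
    ultimately show ?thesis by simp
  qed
  have "\<not> 0 < y \<bullet> y"
  proof
    assume pos: "0 < y \<bullet> y"
    \<comment> \<open>Small enough for the linear term to beat the quadratic one; dividing by
      \<open>a + 1\<close> instead of \<open>a\<close> covers \<open>a = 0\<close>.\<close>
    define t where "t = y \<bullet> y / (a + 1)"
    have t: "0 < t" using pos a by (simp add: t_def)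
    have "2 * (y \<bullet> y) \<le> t * a"
      using key[of t] t by (simp add: power2_eq_square)
    also have "t * a \<le> y \<bullet> y"
      using pos a by (simp add: t_def field_simps)
    finally show False using pos by simp
  qed
  then have "y = 0"
    by simp
  then show ?thesis by (simp add: y_def)
qed

text \<open>Deflation: the quadratic form is maximised over the unit vectors orthogonal to the
  eigenvectors found so far. Their orthogonal complement is invariant by symmetry, so the maximiser
  is an eigenvector. The complements shrink, so the eigenvalues decrease.\<close>

lemma ordered_eigenbasis_exists:
  fixes M :: "real^'n^'n"
  assumes sym: "transpose M = M"
  obtains ev v where "ordered_eigenbasis M ev v"
proof -
  \<comment> \<open>The third conjunct is carried through the induction because the ordering of the
    eigenvalues is read off from it at the end.\<close>
  have "\<exists>ev v. (\<forall>j<k. M *v v j = ev j *\<^sub>R v j)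
      \<and> (\<forall>i<k. \<forall>j<k. v i \<bullet> v j = (if i = j then 1 else 0))
      \<and> (\<forall>j<k. \<forall>x. (\<forall>i<j. v i \<bullet> x = 0) \<longrightarrow> x \<bullet> (M *v x) \<le> ev j * (x \<bullet> x))"
    if "k \<le> CARD('n)" for k
    using that
  proof (induction k)
    case 0
    show ?case by simp
  next
    case (Suc k)
    then have "k \<le> CARD('n)" by simp
    from Suc.IH[OF this] obtain ev and v :: "nat \<Rightarrow> real^'n" where
      eig: "\<And>j. j < k \<Longrightarrow> M *v v j = ev j *\<^sub>R v j" and
      orth: "\<And>i j. i < k \<Longrightarrow> j < k \<Longrightarrow> v i \<bullet> v j = (if i = j then 1 else 0)" and
      max: "\<And>j x. j < k \<Longrightarrow> (\<forall>i<j. v i \<bullet> x = 0) \<Longrightarrow> x \<bullet> (M *v x) \<le> ev j * (x \<bullet> x)"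
      by metis
    define W where "W = {x. \<forall>i<k. v i \<bullet> x = 0}"
    have sub: "subspace W"
      by (auto simp: W_def subspace_def inner_add_right)
    have inv: "M *v x \<in> W" if "x \<in> W" for x
    proof -
      have "v i \<bullet> (M *v x) = 0" if "i < k" for i
        using that \<open>x \<in> W\<close> eig[OF that] by (simp add: inner_matrix_vector_mult sym W_def)
      then show ?thesis by (simp add: W_def)
    qed
    \<comment> \<open>Fewer vectors than the dimension leave a nonzero \<open>x0\<close> in
      \<open>W\<close>, so the compact set \<open>?K\<close> is not empty.\<close>
    have "card (v ` {..<k}) < CARD('n)"
      using card_image_le[of "{..<k}" v] Suc.prems by simp
    then obtain x0 where x0: "x0 \<noteq> 0" "\<And>w. w \<in> v ` {..<k} \<Longrightarrow> w \<bullet> x0 = 0"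
      using exists_orthogonal_vector[of "v ` {..<k}"] by blast
    then have "x0 \<in> W"
      by (simp add: W_def)
    let ?K = "sphere 0 1 \<inter> W"
    have "compact ?K"
      by (intro compact_Int_closed closed_subspace sub) simp
    moreover have "(1 / norm x0) *\<^sub>R x0 \<in> ?K"
      using \<open>x0 \<noteq> 0\<close> \<open>x0 \<in> W\<close> sub by (simp add: subspace_mul)
    moreover have "continuous_on ?K (\<lambda>x. x \<bullet> (M *v x))"
      by (intro continuous_intros matrix_vector_mult_linear_continuous_on)
    ultimately obtain u where u: "u \<in> ?K" and
      umax: "\<And>x. x \<in> ?K \<Longrightarrow> x \<bullet> (M *v x) \<le> u \<bullet> (M *v u)"
      using continuous_attains_sup[of ?K "\<lambda>x. x \<bullet> (M *v x)"] by blast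
    define l where "l = u \<bullet> (M *v u)"
    have uu: "u \<bullet> u = 1"
      using u by (simp add: dot_square_norm)
    have lmax: "x \<bullet> (M *v x) \<le> l * (x \<bullet> x)" if "x \<in> W" for x
    proof (cases "x = 0")
      case False
      then have "(1 / norm x) *\<^sub>R x \<in> ?K"
        using that sub by (simp add: subspace_mul)
      then have "((1 / norm x) *\<^sub>R x) \<bullet> (M *v ((1 / norm x) *\<^sub>R x)) \<le> l"
        unfolding l_def by (rule umax)
      then show ?thesis
        using False by (simp add: matrix_vector_mult_scaleR dot_square_norm field_simps power2_eq_square)
    qed simp
    have Mu: "M *v u = l *\<^sub>R u"
      by (rule Rayleigh_maximiser_eigenvector[OF sym sub inv]) (use u uu lmax in \<open>auto simp: l_def\<close>)
    have uv: "v i \<bullet> u = 0" "u \<bullet> v i = 0" if "i < k" for i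
      using u that by (auto simp: W_def inner_commute[of u])
    let ?ev = "ev(k := l)" and ?v = "v(k := u)"
    have "\<forall>j<Suc k. M *v ?v j = ?ev j *\<^sub>R ?v j"
      using eig Mu by (simp add: less_Suc_eq)
    moreover have "\<forall>i<Suc k. \<forall>j<Suc k. ?v i \<bullet> ?v j = (if i = j then 1 else 0)"
      using orth uv uu by (auto simp: less_Suc_eq)
    moreover have "\<forall>j<Suc k. \<forall>x. (\<forall>i<j. ?v i \<bullet> x = 0) \<longrightarrow> x \<bullet> (M *v x) \<le> ?ev j * (x \<bullet> x)"
      using max lmax by (auto simp: less_Suc_eq W_def)
    ultimately show ?case by blast
  qed
  from this[OF order_refl] obtain ev and v :: "nat \<Rightarrow> real^'n" where
    eig: "\<forall>j<CARD('n). M *v v j = ev j *\<^sub>R v j" and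
    orth: "\<forall>i<CARD('n). \<forall>j<CARD('n). v i \<bullet> v j = (if i = j then 1 else 0)" and
    max: "\<forall>j<CARD('n). \<forall>x. (\<forall>i<j. v i \<bullet> x = 0) \<longrightarrow> x \<bullet> (M *v x) \<le> ev j * (x \<bullet> x)"
    by (elim exE conjE)
  \<comment> \<open>\<open>v j\<close> is orthogonal to all eigenvectors of index below
    \<open>i\<close>, so it competes in the maximum \<open>ev i\<close>, with value
    \<open>ev j\<close>.\<close>
  have "ev j \<le> ev i" if "i \<le> j" "j < CARD('n)" for i j
  proof -
    have "v j \<bullet> (M *v v j) \<le> ev i * (v j \<bullet> v j)"
      using max[rule_format, of i "v j"] orth that by simp
    then show ?thesis
      using eig orth that by simp
  qed
  then have "ordered_eigenbasis M ev v"
    unfolding ordered_eigenbasis_def using eig orth by simp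
  then show ?thesis by (rule that)
qed

section \<open>Diagonalisation in an orthonormal eigenbasis\<close>

definition diagonal_matrix :: "('n \<Rightarrow> real) \<Rightarrow> real^'n^'n" where
  "diagonal_matrix a = (\<chi> i j. if i = j then a i else 0)"

lemma transpose_diagonal_matrix: "transpose (diagonal_matrix a) = diagonal_matrix a"
  by (auto simp: diagonal_matrix_def transpose_def vec_eq_iff)

lemma mult_diagonal_matrix_component: "(A ** diagonal_matrix a) $ i $ j = A $ i $ j * a j"
  by (simp add: diagonal_matrix_def matrix_matrix_mult_def if_distrib cong: if_cong)

lemma diagonal_matrix_vector_component: "(diagonal_matrix a *v x) $ i = a i * x $ i"
  by (simp add: diagonal_matrix_def matrix_vector_mult_def if_distrib[of "\<lambda>u. u * _"] cong: if_cong)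

lemma diagonal_matrix_mult: "diagonal_matrix a ** diagonal_matrix b = diagonal_matrix (\<lambda>i. a i * b i)"
  by (simp add: vec_eq_iff mult_diagonal_matrix_component) (simp add: diagonal_matrix_def)

lemma det_diagonal_matrix: "det (diagonal_matrix a) = (\<Prod>i\<in>UNIV. a i)"
  by (subst det_diagonal) (simp_all add: diagonal_matrix_def)

lemma trace_diagonal_matrix: "trace (diagonal_matrix a) = (\<Sum>i\<in>UNIV. a i)"
  by (simp add: trace_def diagonal_matrix_def)

text \<open>The ordering is dropped because compressing a matrix to the complement of its top
  eigenvectors keeps the eigenvectors but destroys the order of the eigenvalues.\<close>

definition orthonormal_eigenbasis :: "real^'n^'n \<Rightarrow> (nat \<Rightarrow> real) \<Rightarrow> (nat \<Rightarrow> real^'n) \<Rightarrow> bool" where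
  "orthonormal_eigenbasis M ev v \<longleftrightarrow>
     (\<forall>j<CARD('n). M *v v j = ev j *\<^sub>R v j) \<and>
     (\<forall>i<CARD('n). \<forall>j<CARD('n). v i \<bullet> v j = (if i = j then 1 else 0))"

lemma ordered_eigenbasisD:
  fixes M :: "real^'n^'n"
  assumes "ordered_eigenbasis M ev v"
  shows "orthonormal_eigenbasis M ev v" and "i \<le> j \<Longrightarrow> j < CARD('n) \<Longrightarrow> ev j \<le> ev i"
  using assms by (auto simp: ordered_eigenbasis_def orthonormal_eigenbasis_def)

text \<open>Eigenpairs are numbered by naturals, matrix columns by the elements of a type;
  \<open>g\<close> translates between the two. The columns of \<open>U\<close> are the
  eigenvectors.\<close>

lemma orthonormal_eigenbasis_diagonalises:
  fixes M :: "real^'n^'n"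
  assumes eb: "orthonormal_eigenbasis M ev v"
  obtains g :: "'n \<Rightarrow> nat" and U :: "real^'n^'n" where
    "bij_betw g UNIV {..<CARD('n)}" "\<And>i k. U $ i $ k = v (g k) $ i"
    "transpose U ** U = mat 1" "U ** transpose U = mat 1"
    "M = U ** diagonal_matrix (\<lambda>k. ev (g k)) ** transpose U"
proof -
  obtain g :: "'n \<Rightarrow> nat" where g: "bij_betw g UNIV {..<CARD('n)}"
    using ex_bij_betw_finite_nat[of "UNIV :: 'n set"] by (auto simp: atLeast0LessThan)
  then have lt: "g k < CARD('n)" and inj: "g k = g l \<longleftrightarrow> k = l" for k l
    by (auto simp: bij_betw_def inj_def)
  define U :: "real^'n^'n" where "U = (\<chi> i k. v (g k) $ i)"
  have UU: "transpose U ** U = mat 1"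
    using eb lt inj
    by (simp add: vec_eq_iff matrix_mult_transpose_dot_column U_def column_def mat_def
        orthonormal_eigenbasis_def)
  then have UU': "U ** transpose U = mat 1"
    by (simp add: matrix_left_right_inverse)
  have "(M ** U) $ i $ k = (M *v v (g k)) $ i" for i k
    by (simp add: matrix_matrix_mult_def matrix_vector_mult_def U_def)
  then have "M ** U = U ** diagonal_matrix (\<lambda>k. ev (g k))"
    using eb lt by (simp add: vec_eq_iff mult_diagonal_matrix_component orthonormal_eigenbasis_def)
      (simp add: U_def)
  then have "M = U ** diagonal_matrix (\<lambda>k. ev (g k)) ** transpose U"
    by (metis UU' matrix_mul_assoc matrix_mul_rid)
  with g UU UU' show ?thesis
    by (intro that[of g U]) (simp_all add: U_def)
qed

lemma orthonormal_eigenbasis_det_trace: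
  fixes M :: "real^'n^'n"
  assumes "orthonormal_eigenbasis M ev v"
  shows "det M = (\<Prod>j<CARD('n). ev j)" and "trace M = (\<Sum>j<CARD('n). ev j)"
proof -
  obtain g :: "'n \<Rightarrow> nat" and U :: "real^'n^'n" where g: "bij_betw g UNIV {..<CARD('n)}"
    and U: "transpose U ** U = mat 1" "U ** transpose U = mat 1"
    and M: "M = U ** diagonal_matrix (\<lambda>k. ev (g k)) ** transpose U"
    using orthonormal_eigenbasis_diagonalises[OF assms] by metis
  have "det U * det U = 1"
    using arg_cong[OF U(1), of det] by (simp add: det_mul)
  then have "det M = (\<Prod>k\<in>UNIV. ev (g k))"
    by (simp add: M det_mul det_diagonal_matrix)
  then show "det M = (\<Prod>j<CARD('n). ev j)"
    using g by (simp add: prod.reindex_bij_betw)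
  have "trace M = trace (transpose U ** (U ** diagonal_matrix (\<lambda>k. ev (g k))))"
    unfolding M by (rule trace_mul_sym)
  also have "\<dots> = (\<Sum>k\<in>UNIV. ev (g k))"
    by (simp add: matrix_mul_assoc U trace_diagonal_matrix)
  finally show "trace M = (\<Sum>j<CARD('n). ev j)"
    using g by (simp add: sum.reindex_bij_betw)
qed

text \<open>Parseval's identity and its weighted form, computed in the coordinates
  \<open>transpose U *v x\<close>.\<close>

lemma orthonormal_eigenbasis_quadratic_form:
  fixes M :: "real^'n^'n"
  assumes "orthonormal_eigenbasis M ev v"
  shows "x \<bullet> (M *v x) = (\<Sum>j<CARD('n). ev j * (v j \<bullet> x)\<^sup>2)"
    and "x \<bullet> x = (\<Sum>j<CARD('n). (v j \<bullet> x)\<^sup>2)"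
proof -
  obtain g :: "'n \<Rightarrow> nat" and U :: "real^'n^'n" where g: "bij_betw g UNIV {..<CARD('n)}"
    and Uv: "\<And>i k. U $ i $ k = v (g k) $ i"
    and U: "transpose U ** U = mat 1" "U ** transpose U = mat 1"
    and M: "M = U ** diagonal_matrix (\<lambda>k. ev (g k)) ** transpose U"
    using orthonormal_eigenbasis_diagonalises[OF assms] by metis
  define y where "y = transpose U *v x"
  have y: "y $ k = v (g k) \<bullet> x" for k
    by (simp add: y_def matrix_vector_mult_def transpose_def Uv inner_vec_def)
  have "x \<bullet> (M *v x) = y \<bullet> (diagonal_matrix (\<lambda>k. ev (g k)) *v y)"
    by (simp add: M y_def matrix_vector_mul_assoc[symmetric]) (simp add: inner_matrix_vector_mult)
  also have "\<dots> = (\<Sum>k\<in>UNIV. ev (g k) * (v (g k) \<bullet> x)\<^sup>2)"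
    by (simp add: inner_vec_def diagonal_matrix_vector_component y power2_eq_square ac_simps)
  finally show "x \<bullet> (M *v x) = (\<Sum>j<CARD('n). ev j * (v j \<bullet> x)\<^sup>2)"
    using sum.reindex_bij_betw[OF g, of "\<lambda>j. ev j * (v j \<bullet> x)\<^sup>2"] by simp
  have "x \<bullet> x = y \<bullet> y"
    using inner_matrix_vector_mult[of y "transpose U" x]
    by (simp add: y_def matrix_vector_mul_assoc U)
  also have "\<dots> = (\<Sum>k\<in>UNIV. (v (g k) \<bullet> x)\<^sup>2)"
    by (simp add: inner_vec_def y power2_eq_square)
  finally show "x \<bullet> x = (\<Sum>j<CARD('n). (v j \<bullet> x)\<^sup>2)"
    using sum.reindex_bij_betw[OF g, of "\<lambda>j. (v j \<bullet> x)\<^sup>2"] by simp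
qed

section \<open>Square roots of positive definite matrices\<close>

lemma pos_def_diagonal_matrix:
  assumes "\<And>i. 0 < a i"
  shows "pos_def_matrix (diagonal_matrix a)"
proof -
  have "0 < x \<bullet> (diagonal_matrix a *v x)" if nz: "x \<noteq> 0" for x :: "real^'a"
  proof -
    obtain i where "x $ i \<noteq> 0"
      using nz by (metis vec_eq_iff zero_index)
    then have "0 < (\<Sum>i\<in>UNIV. a i * (x $ i)\<^sup>2)"
      using assms by (intro sum_pos2[of _ i]) (auto simp: less_imp_le)
    then show ?thesis
      by (simp add: inner_vec_def diagonal_matrix_vector_component power2_eq_square ac_simps)
  qed
  then show ?thesis
    by (simp add: pos_def_matrix_def transpose_diagonal_matrix)
qed

lemma pos_def_eigenvalue_pos:
  fixes M :: "real^'n^'n"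
  assumes "pos_def_matrix M" "orthonormal_eigenbasis M ev v" "j < CARD('n)"
  shows "0 < ev j"
proof -
  have 1: "v j \<bullet> v j = 1"
    using assms by (simp add: orthonormal_eigenbasis_def)
  then have "v j \<noteq> 0" by auto
  then have "0 < v j \<bullet> (M *v v j)"
    by (rule pos_def_matrixD(3)[OF assms(1)])
  then show ?thesis
    using assms 1 by (simp add: orthonormal_eigenbasis_def)
qed

lemma pos_def_det_pos:
  fixes M :: "real^'n^'n"
  assumes "pos_def_matrix M"
  shows "0 < det M"
proof -
  obtain ev v where eb: "orthonormal_eigenbasis M ev v"
    using ordered_eigenbasis_exists[OF pos_def_matrixD(1)[OF assms]] ordered_eigenbasisD(1) by metis
  then show ?thesis
    unfolding orthonormal_eigenbasis_det_trace(1)[OF eb]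
    by (intro prod_pos ballI pos_def_eigenvalue_pos[OF assms eb]) simp
qed

text \<open>In an eigenbasis it suffices to take the square roots of the eigenvalues, which are
  positive.\<close>

lemma pos_def_sqrt_exists:
  fixes M :: "real^'n^'n"
  assumes pd: "pos_def_matrix M"
  obtains R where "pos_def_matrix R" "R ** R = M"
proof -
  obtain ev v where eb: "orthonormal_eigenbasis M ev v"
    using ordered_eigenbasis_exists[OF pos_def_matrixD(1)[OF pd]] ordered_eigenbasisD(1) by metis
  obtain g :: "'n \<Rightarrow> nat" and U :: "real^'n^'n" where g: "bij_betw g UNIV {..<CARD('n)}"
    and U: "transpose U ** U = mat 1" "U ** transpose U = mat 1"
    and M: "M = U ** diagonal_matrix (\<lambda>k. ev (g k)) ** transpose U"
    using orthonormal_eigenbasis_diagonalises[OF eb] by metis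
  have pos: "0 < ev (g k)" for k
    using pos_def_eigenvalue_pos[OF pd eb] g by (auto simp: bij_betw_def)
  define E where "E = diagonal_matrix (\<lambda>k. sqrt (ev (g k)))"
  have EE: "E ** E = diagonal_matrix (\<lambda>k. ev (g k))"
    using pos by (simp add: E_def diagonal_matrix_mult less_imp_le)
  have "(U ** E ** transpose U) ** (U ** E ** transpose U)
      = U ** E ** (transpose U ** U) ** E ** transpose U"
    by (simp add: matrix_mul_assoc)
  also have "\<dots> = U ** (E ** E) ** transpose U"
    by (simp add: U matrix_mul_assoc)
  finally have "(U ** E ** transpose U) ** (U ** E ** transpose U) = M"
    by (simp add: EE M)
  moreover have "pos_def_matrix (U ** E ** transpose U)"
  proof -
    have "pos_def_matrix E"
      unfolding E_def using pos by (intro pos_def_diagonal_matrix) simp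
    moreover have "invertible (transpose U)"
      using U(2) by (auto simp: invertible_left_inverse)
    ultimately have "pos_def_matrix (transpose (transpose U) ** E ** transpose U)"
      by (rule pos_def_matrix_congruence)
    then show ?thesis by simp
  qed
  ultimately show ?thesis by (intro that)
qed

text \<open>
  With \<open>T = R - Q\<close> one has \<open>R T + T Q = R\<^sup>2 - Q\<^sup>2 = 0\<close>; evaluating this at an eigenvector of \<open>T\<close>
  shows that the eigenvalue is \<open>0\<close>.
\<close>

lemma pos_def_sqrt_unique:
  fixes R Q :: "real^'n^'n"
  assumes R: "pos_def_matrix R" and Q: "pos_def_matrix Q" and eq: "R ** R = Q ** Q"
  shows "R = Q"
proof -
  define T where "T = R - Q"
  have sym: "transpose T = T"
    using R Q by (simp add: T_def transpose_diff pos_def_matrixD(1))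
  obtain ev v where eb: "orthonormal_eigenbasis T ev v"
    using ordered_eigenbasis_exists[OF sym] ordered_eigenbasisD(1) by metis
  obtain g :: "'n \<Rightarrow> nat" and U :: "real^'n^'n" where g: "bij_betw g UNIV {..<CARD('n)}"
    and T: "T = U ** diagonal_matrix (\<lambda>k. ev (g k)) ** transpose U"
    using orthonormal_eigenbasis_diagonalises[OF eb] by metis
  have RT: "R ** T + T ** Q = 0"
    using eq by (simp add: T_def matrix_distribs)
  have "ev j = 0" if j: "j < CARD('n)" for j
  proof -
    have v: "T *v v j = ev j *\<^sub>R v j" "v j \<bullet> v j = 1"
      using eb j by (auto simp: orthonormal_eigenbasis_def)
    then have "v j \<noteq> 0" by auto
    then have "0 < v j \<bullet> (R *v v j) + v j \<bullet> (Q *v v j)"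
      by (intro add_pos_pos pos_def_matrixD(3) R Q)
    moreover have "v j \<bullet> (R *v (T *v v j)) + v j \<bullet> (T *v (Q *v v j)) = 0"
      using arg_cong[OF RT, of "\<lambda>K. v j \<bullet> (K *v v j)"]
      by (simp add: matrix_vector_mult_add_rdistrib inner_add_right matrix_vector_mul_assoc)
    then have "ev j * (v j \<bullet> (R *v v j) + v j \<bullet> (Q *v v j)) = 0"
      using v(1) by (simp add: inner_matrix_vector_mult[of "v j" T] sym matrix_vector_mult_scaleR
          algebra_simps)
    ultimately show ?thesis by simp
  qed
  moreover have "g k < CARD('n)" for k
    using g by (auto simp: bij_betw_def)
  ultimately have "diagonal_matrix (\<lambda>k. ev (g k)) = 0"
    by (simp add: diagonal_matrix_def vec_eq_iff)
  then have "T = 0"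
    by (simp add: T)
  then show ?thesis
    by (simp add: T_def)
qed

text \<open>Existence and uniqueness together make the definite description in
  \<open>matrix_sqrt\<close> denote.\<close>

lemma
  assumes "pos_def_matrix M"
  shows pos_def_matrix_sqrt: "pos_def_matrix (matrix_sqrt M)"
    and matrix_sqrt_mult_self: "matrix_sqrt M ** matrix_sqrt M = M"
proof -
  have "\<exists>!R. pos_def_matrix R \<and> R ** R = M"
    using pos_def_sqrt_exists[OF assms] pos_def_sqrt_unique by metis
  from theI'[OF this] show "pos_def_matrix (matrix_sqrt M)" "matrix_sqrt M ** matrix_sqrt M = M"
    by (auto simp: matrix_sqrt_def)
qed

lemma
  fixes M :: "real^'n^'n"
  assumes pd: "pos_def_matrix M"
  shows matrix_invsqrt_left: "matrix_invsqrt M ** matrix_sqrt M = mat 1"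
    and matrix_invsqrt_right: "matrix_sqrt M ** matrix_invsqrt M = mat 1"
    and transpose_matrix_invsqrt: "transpose (matrix_invsqrt M) = matrix_invsqrt M"
    and matrix_invsqrt_mult_self: "matrix_invsqrt M ** matrix_invsqrt M = matrix_inv M"
    and invertible_matrix_invsqrt: "invertible (matrix_invsqrt M)"
proof -
  let ?R = "matrix_sqrt M" and ?Q = "matrix_invsqrt M"
  note R = pos_def_matrixD[OF pos_def_matrix_sqrt[OF pd]]
  show l: "?Q ** ?R = mat 1" and r: "?R ** ?Q = mat 1"
    by (simp_all add: matrix_invsqrt_def R matrix_inv_left matrix_inv_right)
  show "transpose ?Q = ?Q"
    by (simp add: matrix_invsqrt_def R transpose_matrix_inv)
  have "M ** (?Q ** ?Q) = ?R ** (?R ** ?Q) ** ?Q"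
    by (simp add: matrix_mul_assoc matrix_sqrt_mult_self[OF pd])
  then have "M ** (?Q ** ?Q) = mat 1"
    by (simp add: r)
  then show "?Q ** ?Q = matrix_inv M"
    by (simp add: matrix_inv_unique)
  show "invertible ?Q"
    using l by (auto simp: invertible_right_inverse)
qed

section \<open>Determinant inequalities\<close>

lemma trace_scaleR: "trace (c *\<^sub>R A) = c * trace A" for A :: "real^'n^'n"
  by (simp add: trace_def sum_distrib_left)

text \<open>
  In the eigenvalues \<open>t\<close> of \<open>\<Delta>\<^sup>-\<^sup>1\<^sup>/\<^sup>2 M \<Delta>\<^sup>-\<^sup>1\<^sup>/\<^sup>2\<close> this is \<open>ln t \<le> t - 1\<close>.
\<close>

lemma ln_det_le_trace:
  fixes \<Delta> M :: "real^'n^'n"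
  assumes \<Delta>: "pos_def_matrix \<Delta>" and M: "pos_def_matrix M"
  shows "ln (det M) + real CARD('n) \<le> ln (det \<Delta>) + trace (matrix_inv \<Delta> ** M)"
proof -
  let ?Q = "matrix_invsqrt \<Delta>"
  define T where "T = ?Q ** M ** ?Q"
  have T: "pos_def_matrix T"
    using pos_def_matrix_congruence[OF M invertible_matrix_invsqrt[OF \<Delta>]]
    by (simp add: T_def transpose_matrix_invsqrt[OF \<Delta>])
  obtain ev v where eb: "orthonormal_eigenbasis T ev v"
    using ordered_eigenbasis_exists[OF pos_def_matrixD(1)[OF T]] ordered_eigenbasisD(1) by metis
  note pos = pos_def_eigenvalue_pos[OF T eb]
  have "det \<Delta> * det (matrix_inv \<Delta>) = 1"
    using arg_cong[OF matrix_inv_right[OF pos_def_matrixD(2)[OF \<Delta>]], of det]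
    by (simp add: det_mul)
  moreover have "det T = det (matrix_inv \<Delta>) * det M"
    by (simp add: T_def det_mul flip: matrix_invsqrt_mult_self[OF \<Delta>])
  ultimately have "det M = det \<Delta> * det T"
    by (simp add: ac_simps)
  then have "ln (det M) = ln (det \<Delta>) + ln (det T)"
    using pos_def_det_pos[OF \<Delta>] pos_def_det_pos[OF T] by (simp add: ln_mult)
  also have "ln (det T) = (\<Sum>j<CARD('n). ln (ev j))"
    unfolding orthonormal_eigenbasis_det_trace(1)[OF eb]
    by (intro ln_prod) (use pos less_imp_neq in \<open>fastforce+\<close>)
  also have "\<dots> \<le> (\<Sum>j<CARD('n). ev j - 1)"
    using pos by (intro sum_mono ln_le_minus_one) simp
  also have "\<dots> = trace T - real CARD('n)"
    by (simp add: orthonormal_eigenbasis_det_trace(2)[OF eb] sum_subtractf)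
  \<comment> \<open>Cyclicity of the trace brings the two factors \<open>?Q\<close> together, and
    their product is the inverse of \<Delta>.\<close>
  also have "trace T = trace (matrix_inv \<Delta> ** M)"
    using trace_mul_sym[of "?Q ** M" ?Q]
    by (simp add: T_def matrix_mul_assoc matrix_invsqrt_mult_self[OF \<Delta>])
  finally show ?thesis by simp
qed

text \<open>
  The \<open>j\<close> leading eigenvectors of \<open>N\<close>, the columns of \<open>A\<close> and the eigenvectors of \<open>S\<close> of index
  above \<open>j + d\<close> are fewer vectors than the dimension, so some \<open>x \<noteq> 0\<close> is orthogonal to all of
  them, and it compares the two quadratic forms.
\<close>

lemma eigenvalue_shift_le:
  fixes N S :: "real^'p^'p" and A :: "real^'d^'p"
  assumes N: "ordered_eigenbasis N nu w" and S: "ordered_eigenbasis S ev v"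
    and agree: "\<And>x. transpose A *v x = 0 \<Longrightarrow> x \<bullet> (N *v x) = x \<bullet> (S *v x)"
    and j: "j + CARD('d) < CARD('p)"
  shows "ev (j + CARD('d)) \<le> nu j"
proof -
  let ?d = "CARD('d)" and ?p = "CARD('p)"
  define W1 where "W1 = w ` {..<j}"
  define W2 where "W2 = range (\<lambda>k. column k A)"
  define W3 where "W3 = v ` {Suc (j + ?d)..<?p}"
  have "card W1 \<le> j" "card W2 \<le> ?d" "card W3 \<le> ?p - Suc (j + ?d)"
    unfolding W1_def W2_def W3_def
    using card_image_le[of "{..<j}" w] card_image_le[of UNIV "\<lambda>k. column k A"]
      card_image_le[of "{Suc (j + ?d)..<?p}" v] by auto
  \<comment> \<open>The sizes add up to at most \<open>j + d + (p - (j + d + 1)) = p - 1\<close>,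
    which is why \<open>W3\<close> starts one index above \<open>j + d\<close>.\<close>
  then have card: "card (W1 \<union> W2 \<union> W3) < ?p"
    using j card_Un_le[of "W1 \<union> W2" W3] card_Un_le[of W1 W2] by linarith
  have "finite (W1 \<union> W2 \<union> W3)"
    by (simp add: W1_def W2_def W3_def)
  from exists_orthogonal_vector[OF this card]
  obtain x where x: "x \<noteq> 0" "\<And>y. y \<in> W1 \<union> W2 \<union> W3 \<Longrightarrow> y \<bullet> x = 0"
    by blast
  have "(transpose A *v x) $ k = column k A \<bullet> x" for k
    by (simp add: matrix_vector_mult_def transpose_def column_def inner_vec_def)
  moreover have "column k A \<bullet> x = 0" for k
    using x(2)[of "column k A"] by (simp add: W2_def)
  ultimately have "transpose A *v x = 0"
    by (simp add: vec_eq_iff)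
  then have "x \<bullet> (N *v x) = x \<bullet> (S *v x)" by (rule agree)
  \<comment> \<open>Summands of index below \<open>j\<close> vanish by orthogonality to
    \<open>W1\<close>, and the others have eigenvalue at most \<open>nu j\<close>. For
    \<open>S\<close>, orthogonality to \<open>W3\<close> leaves only the indices up to
    \<open>j + d\<close>, where the eigenvalues are at least \<open>ev (j + d)\<close>.\<close>
  moreover have "x \<bullet> (N *v x) \<le> nu j * (x \<bullet> x)"
    unfolding orthonormal_eigenbasis_quadratic_form[OF ordered_eigenbasisD(1)[OF N]] sum_distrib_left
  proof (intro sum_mono)
    fix i assume "i \<in> {..<?p}"
    then show "nu i * (w i \<bullet> x)\<^sup>2 \<le> nu j * (w i \<bullet> x)\<^sup>2"
      using x(2)[of "w i"] ordered_eigenbasisD(2)[OF N, of j i]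
      by (cases "i < j") (auto simp: W1_def intro: mult_right_mono)
  qed
  moreover have "ev (j + ?d) * (x \<bullet> x) \<le> x \<bullet> (S *v x)"
    unfolding orthonormal_eigenbasis_quadratic_form[OF ordered_eigenbasisD(1)[OF S]] sum_distrib_left
  proof (intro sum_mono)
    fix i assume "i \<in> {..<?p}"
    then show "ev (j + ?d) * (v i \<bullet> x)\<^sup>2 \<le> ev i * (v i \<bullet> x)\<^sup>2"
      using x(2)[of "v i"] ordered_eigenbasisD(2)[OF S, of i "j + ?d"] j
      by (cases "j + ?d < i") (auto simp: W3_def intro: mult_right_mono)
  qed
  ultimately have "ev (j + ?d) * (x \<bullet> x) \<le> nu j * (x \<bullet> x)" by simp
  then show ?thesis
    using x(1) by simp
qed

lemma orthonormal_eigenbasis_add_mat_1: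
  assumes "orthonormal_eigenbasis M ev v"
  shows "orthonormal_eigenbasis (mat 1 + M) (\<lambda>j. 1 + ev j) v"
  using assms
  by (simp add: orthonormal_eigenbasis_def matrix_vector_mult_add_rdistrib scaleR_add_left)

text \<open>The \<open>p - d\<close> leading eigenvalues of \<open>N\<close> dominate the tail of
  the spectrum of \<open>S\<close> one by one, by \<open>eigenvalue_shift_le\<close>. Each of the
  remaining \<open>d\<close> factors of the determinant is at least 1.\<close>

lemma prod_tail_eigenvalues_le_det:
  fixes N S :: "real^'p^'p" and A :: "real^'d^'p"
  assumes sym: "transpose N = N" and nonneg: "\<And>x. 0 \<le> x \<bullet> (N *v x)"
    and S: "ordered_eigenbasis S ev v" and ev: "\<And>j. 0 \<le> ev j"
    and agree: "\<And>x. transpose A *v x = 0 \<Longrightarrow> x \<bullet> (N *v x) = x \<bullet> (S *v x)"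
    and d: "CARD('d) \<le> CARD('p)"
  shows "(\<Prod>j=CARD('d)..<CARD('p). 1 + ev j) \<le> det (mat 1 + N)"
proof -
  let ?d = "CARD('d)" and ?p = "CARD('p)"
  obtain nu w where N: "ordered_eigenbasis N nu w"
    using ordered_eigenbasis_exists[OF sym] .
  note N' = ordered_eigenbasisD(1)[OF N]
  have nu: "0 \<le> nu j" if "j < ?p" for j
    using nonneg[of "w j"] N' that by (simp add: orthonormal_eigenbasis_def)
  have shift: "ev (j + ?d) \<le> nu j" if "j < ?p - ?d" for j
    using that by (intro eigenvalue_shift_le[OF N S, of A] agree) auto
  have "(\<Prod>j=?d..<?p. 1 + ev j) = (\<Prod>j<?p - ?d. 1 + ev (j + ?d))"
    using d prod.shift_bounds_nat_ivl[of "\<lambda>j. 1 + ev j" 0 ?d "?p - ?d"]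
    by (simp add: atLeast0LessThan)
  \<comment> \<open>The factor 1 stands in for the last \<open>d\<close> factors of the determinant,
    which replace it in the next step.\<close>
  also have "\<dots> \<le> (\<Prod>j<?p - ?d. 1 + nu j) * 1"
    unfolding mult_1_right using shift ev by (intro prod_mono) (simp add: add_nonneg_nonneg)
  also have "(\<Prod>j<?p - ?d. 1 + nu j) * 1
      \<le> (\<Prod>j<?p - ?d. 1 + nu j) * (\<Prod>j=?p - ?d..<?p. 1 + nu j)"
    using nu by (intro mult_left_mono prod_ge_1 prod_nonneg) (simp_all add: add_nonneg_nonneg)
  also have "\<dots> = (\<Prod>j<?p. 1 + nu j)"
    using prod.atLeastLessThan_concat[of 0 "?p - ?d" ?p "\<lambda>j. 1 + nu j"]
    by (simp add: atLeast0LessThan)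
  also have "\<dots> = det (mat 1 + N)"
    by (simp add: orthonormal_eigenbasis_det_trace(1)[OF orthonormal_eigenbasis_add_mat_1[OF N']])
  finally show ?thesis .
qed

text \<open>\<open>P\<close> is the orthogonal projection that kills the first \<open>d\<close>
  eigenvectors and fixes the others. So \<open>P ** S ** P\<close> has the same eigenvectors as
  \<open>S\<close>, with the first \<open>d\<close> eigenvalues replaced by 0, and these contribute
  the factor 1.\<close>

lemma det_truncated_spectrum:
  fixes S :: "real^'p^'p" and V :: "real^'d^'p"
  assumes S: "orthonormal_eigenbasis S ev v" and d: "CARD('d) \<le> CARD('p)"
    and col: "bij_betw col (UNIV :: 'd set) {..<CARD('d)}"
    and V: "V = (\<chi> i k. v (col k) $ i)"
  defines "P \<equiv> mat 1 - V ** transpose V"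
  shows "det (mat 1 + P ** S ** P) = (\<Prod>j=CARD('d)..<CARD('p). 1 + ev j)"
proof -
  let ?d = "CARD('d)" and ?p = "CARD('p)"
  have lt: "col k < ?d" for k
    using col by (auto simp: bij_betw_def)
  have Vik: "V $ i $ k = v (col k) $ i" for i k
    by (simp add: V)
  have VV: "(V ** transpose V) *v v j = (if j < ?d then v j else 0)" if j: "j < ?p" for j
  proof -
    have y: "(transpose V *v v j) $ k = (if col k = j then 1 else 0)" for k
    proof -
      have "(transpose V *v v j) $ k = v (col k) \<bullet> v j"
        by (simp add: Vik matrix_vector_mult_def transpose_def inner_vec_def)
      then show ?thesis
        using S j lt[of k] d by (simp add: orthonormal_eigenbasis_def)
    qed
    have "((V ** transpose V) *v v j) $ i = (if j < ?d then v j else 0) $ i" for i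
    proof -
      have "((V ** transpose V) *v v j) $ i = (\<Sum>k\<in>UNIV. v (col k) $ i * (transpose V *v v j) $ k)"
        unfolding matrix_vector_mul_assoc[symmetric] by (simp add: matrix_vector_mult_def[of V "transpose V *v v j"] Vik)
      also have "\<dots> = (\<Sum>k\<in>UNIV. v (col k) $ i * (if col k = j then 1 else 0))"
        by (simp add: y)
      also have "\<dots> = (\<Sum>m<?d. v m $ i * (if m = j then 1 else 0))"
        by (rule sum.reindex_bij_betw[OF col])
      finally show ?thesis
        by (simp add: if_distrib cong: if_cong)
    qed
    then show ?thesis by (simp add: vec_eq_iff)
  qed
  have Pv: "P *v v j = (if j < ?d then 0 else v j)" if "j < ?p" for j
    using VV[OF that] by (simp add: P_def matrix_vector_mult_diff_rdistrib)
  define ev' where "ev' j = (if j < ?d then 0 else ev j)" for j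
  have "(P ** S ** P) *v v j = ev' j *\<^sub>R v j" if "j < ?p" for j
    unfolding matrix_vector_mul_assoc[symmetric]
    using Pv[OF that] S that
    by (simp add: orthonormal_eigenbasis_def matrix_vector_mult_scaleR ev'_def)
  then have "orthonormal_eigenbasis (P ** S ** P) ev' v"
    using S by (simp add: orthonormal_eigenbasis_def)
  then have "orthonormal_eigenbasis (mat 1 + P ** S ** P) (\<lambda>j. 1 + ev' j) v"
    by (rule orthonormal_eigenbasis_add_mat_1)
  then have "det (mat 1 + P ** S ** P) = (\<Prod>j<?p. 1 + ev' j)"
    by (rule orthonormal_eigenbasis_det_trace(1))
  also have "\<dots> = (\<Prod>j=?d..<?p. 1 + ev' j)"
    by (rule prod.mono_neutral_right) (auto simp: ev'_def)
  also have "\<dots> = (\<Prod>j=?d..<?p. 1 + ev j)"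
    by (simp add: ev'_def)
  finally show ?thesis .
qed

section \<open>The minimal determinant under a rank constraint\<close>

lemma psd_congruence:
  fixes G :: "real^'r^'r" and C :: "real^'r^'p"
  assumes "\<And>y. 0 \<le> y \<bullet> (G *v y)"
  shows "0 \<le> x \<bullet> ((C ** G ** transpose C) *v x)"
  using assms[of "transpose C *v x"]
  by (simp add: matrix_vector_mul_assoc[symmetric]) (simp add: inner_matrix_vector_mult)

text \<open>The square root of \<open>D\<close> is factored out of \<open>D + N\<close> on both
  sides.\<close>

lemma det_sandwich_sqrt:
  fixes D N :: "real^'p^'p"
  assumes "pos_def_matrix D"
  shows "det (D + N) = det D * det (mat 1 + matrix_invsqrt D ** N ** matrix_invsqrt D)"
proof -
  let ?R = "matrix_sqrt D" and ?Q = "matrix_invsqrt D"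
  note inv = matrix_invsqrt_left[OF assms] matrix_invsqrt_right[OF assms]
  have "?R ** (mat 1 + ?Q ** N ** ?Q) ** ?R = ?R ** ?R + (?R ** ?Q) ** N ** (?Q ** ?R)"
    by (simp add: matrix_distribs matrix_mul_assoc)
  then have "D + N = ?R ** (mat 1 + ?Q ** N ** ?Q) ** ?R"
    by (simp add: inv matrix_sqrt_mult_self[OF assms])
  then have "det (D + N) = det (?R ** ?R) * det (mat 1 + ?Q ** N ** ?Q)"
    by (simp add: det_mul)
  then show ?thesis
    by (simp add: matrix_sqrt_mult_self[OF assms])
qed

text \<open>The determinant form of reduced-rank regression. Scaling by \<open>D^(-1/2)\<close>
  leaves \<open>det (mat 1 + N)\<close>, where \<open>N\<close> and \<open>S\<close> differ only
  through \<open>A ** B\<close>, which does not act on the kernel of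
  \<open>transpose (?Q ** A)\<close>. For the special \<open>A\<close> and \<open>B\<close> the
  scaled coefficient error is a projection of \<open>?Q ** C\<close>, so the bound is
  attained.\<close>

lemma
  fixes D S :: "real^'p^'p" and G :: "real^'r^'r" and C :: "real^'r^'p"
    and A V :: "real^'d^'p" and B :: "real^'r^'d"
  assumes D: "pos_def_matrix D" and G: "transpose G = G" "\<And>y. 0 \<le> y \<bullet> (G *v y)"
    and S: "S = matrix_invsqrt D ** C ** G ** transpose C ** matrix_invsqrt D"
    and eb: "ordered_eigenbasis S ev v" and ev: "\<And>j. 0 \<le> ev j"
    and d: "CARD('d) \<le> CARD('p)"
  shows det_reduced_rank_ge: "det D * (\<Prod>j=CARD('d)..<CARD('p). 1 + ev j)
      \<le> det (D + (C - A ** B) ** G ** transpose (C - A ** B))"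
      (is "_ * ?prod \<le> _")
    and det_reduced_rank_eq: "\<lbrakk>bij_betw col (UNIV :: 'd set) {..<CARD('d)}; V = (\<chi> i k. v (col k) $ i);
        A = matrix_sqrt D ** V; B = transpose V ** matrix_invsqrt D ** C\<rbrakk>
      \<Longrightarrow> det (D + (C - A ** B) ** G ** transpose (C - A ** B))
        = det D * (\<Prod>j=CARD('d)..<CARD('p). 1 + ev j)"
proof -
  let ?R = "matrix_sqrt D" and ?Q = "matrix_invsqrt D"
  note Qsym = transpose_matrix_invsqrt[OF D]
  define E where "E = C - A ** B"
  define N where "N = ?Q ** (E ** G ** transpose E) ** ?Q"
  have det_eq: "det (D + (C - A ** B) ** G ** transpose (C - A ** B)) = det D * det (mat 1 + N)"
    unfolding N_def E_def by (rule det_sandwich_sqrt[OF D])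
  have N: "N = (?Q ** E) ** G ** transpose (?Q ** E)"
    by (simp add: N_def matrix_transpose_mul Qsym matrix_mul_assoc)
  have S': "S = (?Q ** C) ** G ** transpose (?Q ** C)"
    by (simp add: S matrix_transpose_mul Qsym matrix_mul_assoc)
  have "?prod \<le> det (mat 1 + N)"
  proof (rule prod_tail_eigenvalues_le_det[OF _ _ eb ev _ d])
    show "transpose N = N"
      by (simp add: N matrix_transpose_mul G matrix_mul_assoc)
    show "0 \<le> x \<bullet> (N *v x)" for x
      unfolding N by (rule psd_congruence[OF G(2)])
    show "x \<bullet> (N *v x) = x \<bullet> (S *v x)" if "transpose (?Q ** A) *v x = 0" for x
    proof -
      have "?Q ** E = ?Q ** C - (?Q ** A) ** B"
        by (simp add: E_def matrix_distribs matrix_mul_assoc)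
      \<comment> \<open>The contribution of \<open>A ** B\<close> passes through
        \<open>transpose (?Q ** A) *v x\<close>, which is zero by assumption.\<close>
      then have "transpose (?Q ** E) *v x
          = transpose (?Q ** C) *v x - transpose B *v (transpose (?Q ** A) *v x)"
        by (simp only: transpose_diff matrix_transpose_mul[of "?Q ** A" B]
            matrix_vector_mult_diff_rdistrib matrix_vector_mul_assoc)
      then have eq: "transpose (?Q ** E) *v x = transpose (?Q ** C) *v x"
        using that by simp
      have "x \<bullet> ((Z ** G ** transpose Z) *v x) = (transpose Z *v x) \<bullet> (G *v (transpose Z *v x))"
        for Z :: "real^'r^'p"
        unfolding matrix_vector_mul_assoc[symmetric] by (rule inner_matrix_vector_mult)
      then show ?thesis
        by (simp only: N S' eq)
    qed
  qed
  then show "det D * ?prod \<le> det (D + (C - A ** B) ** G ** transpose (C - A ** B))"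
    unfolding det_eq using pos_def_det_pos[OF D] by (simp add: mult_left_mono)
  assume col: "bij_betw col (UNIV :: 'd set) {..<CARD('d)}" and V: "V = (\<chi> i k. v (col k) $ i)"
    and A: "A = ?R ** V" and B: "B = transpose V ** ?Q ** C"
  define P where "P = mat 1 - V ** transpose V"
  \<comment> \<open>The opposite exponents in \<open>A\<close> and \<open>B\<close> make the scaled
    product equal to \<open>V ** transpose V\<close> applied to \<open>?Q ** C\<close>: the
    projection of the scaled coefficient onto the top eigenvectors.\<close>
  have "?Q ** A = (?Q ** ?R) ** V"
    by (simp add: A matrix_mul_assoc)
  then have "?Q ** A = V"
    by (simp add: matrix_invsqrt_left[OF D])
  then have "?Q ** (A ** B) = V ** transpose V ** ?Q ** C"
    by (simp add: matrix_mul_assoc) (simp add: B matrix_mul_assoc)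
  then have "?Q ** E = P ** (?Q ** C)"
    by (simp add: E_def P_def matrix_distribs matrix_mul_assoc)
  moreover have "transpose P = P"
    by (simp add: P_def transpose_distribs)
  ultimately have "N = P ** S ** P"
    by (simp add: N S' matrix_transpose_mul matrix_mul_assoc)
  then show "det (D + (C - A ** B) ** G ** transpose (C - A ** B)) = det D * ?prod"
    using det_truncated_spectrum[OF ordered_eigenbasisD(1)[OF eb] d col V]
    by (simp add: det_eq P_def)
qed

section \<open>Least squares and the likelihood\<close>

text \<open>Pythagoras: the least squares residual is orthogonal to the columns of \<open>F\<close>,
  so the mixed terms vanish when \<open>C0\<close> is replaced by any other coefficient.\<close>

lemma least_squares_decomposition:
  fixes X :: "real^'p^'n" and F :: "real^'r^'n" and C :: "real^'r^'p"
  assumes SXF: "SXF = c *\<^sub>R (transpose X ** F)" and SFF: "SFF = c *\<^sub>R (transpose F ** F)"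
    and inv: "invertible SFF" and c: "c \<noteq> 0" and C0: "C0 = SXF ** matrix_inv SFF"
    and D: "D = c *\<^sub>R (transpose (X - F ** transpose C0) ** (X - F ** transpose C0))"
  shows "c *\<^sub>R (transpose (X - F ** transpose C) ** (X - F ** transpose C))
    = D + (C0 - C) ** SFF ** transpose (C0 - C)"
proof -
  define L where "L = X - F ** transpose C0"
  define E where "E = C0 - C"
  \<comment> \<open>The normal equations, equivalent to \<open>transpose L ** F = 0\<close>.\<close>
  have "C0 ** SFF = SXF"
    by (simp add: C0 matrix_inv_left[OF inv] flip: matrix_mul_assoc)
  then have "c *\<^sub>R (transpose L ** F) = 0"
    by (auto simp: L_def transpose_distribs matrix_distribs SXF SFF scaleR_diff_right matrix_mul_assoc)
  then have LF: "transpose L ** F = 0"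
    using c by simp
  then have FL: "transpose F ** L = 0"
    by (metis matrix_transpose_mul transpose_transpose transpose_0)
  have "X - F ** transpose C = L + F ** transpose E"
    by (simp add: L_def E_def transpose_diff matrix_distribs)
  then have "transpose (X - F ** transpose C) ** (X - F ** transpose C)
      = transpose L ** L + (transpose L ** F) ** transpose E + E ** (transpose F ** L)
        + E ** (transpose F ** F) ** transpose E"
    by (simp add: transpose_distribs matrix_distribs matrix_mul_assoc)
  then show ?thesis
    by (simp add: LF FL D L_def[symmetric] E_def[symmetric] SFF scaleR_add_right matrix_distribs)
qed

text \<open>A Gram matrix is positive semidefinite, and \<open>L *v x = 0\<close> would put
  \<open>x\<close> into its kernel. This turns the invertibility of \<open>S_FF\<close> and
  \<open>Delta_LS\<close> into positive definiteness.\<close>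

lemma invertible_gram_pos_def:
  fixes L :: "real^'p^'n"
  assumes c: "0 < c" and inv: "invertible (c *\<^sub>R (transpose L ** L))"
  shows "pos_def_matrix (c *\<^sub>R (transpose L ** L))"
proof -
  let ?D = "c *\<^sub>R (transpose L ** L)"
  have form: "x \<bullet> (?D *v x) = c * ((L *v x) \<bullet> (L *v x))" for x
    by (simp add: scaleR_matrix_vector_assoc[symmetric] matrix_vector_mul_assoc[symmetric])
      (simp add: inner_matrix_vector_mult)
  have "0 < x \<bullet> (?D *v x)" if "x \<noteq> 0" for x
  proof -
    have "?D *v x \<noteq> 0"
      using inv that by (metis invertible_left_inverse matrix_left_invertible_ker)
    then have "L *v x \<noteq> 0"
      by (auto simp: scaleR_matrix_vector_assoc[symmetric] matrix_vector_mul_assoc[symmetric])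
    then show ?thesis
      using c by (simp add: form)
  qed
  then show ?thesis
    by (simp add: pos_def_matrix_def transpose_distribs)
qed

section \<open>Eliminating the mean from the likelihood\<close>

lemma trace_psd_congruence:
  fixes M :: "real^'p^'p" and L :: "real^'p^'n"
  assumes "\<And>x. 0 \<le> x \<bullet> (M *v x)"
  shows "0 \<le> trace (L ** M ** transpose L)"
proof -
  have "(L ** M ** transpose L) $ i $ i = row i L \<bullet> (M *v row i L)" for i
  proof -
    have "(L ** M ** transpose L) $ i $ i = axis i 1 \<bullet> ((L ** M ** transpose L) *v axis i 1)"
      by (simp add: matrix_vector_mult_basis inner_axis' column_def)
    also have "\<dots> = (transpose L *v axis i 1) \<bullet> (M *v (transpose L *v axis i 1))"
      unfolding matrix_vector_mul_assoc[symmetric] by (rule inner_matrix_vector_mult)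
    finally show ?thesis
      by (simp add: matrix_vector_mult_basis)
  qed
  then show ?thesis
    using assms by (simp add: trace_def sum_nonneg)
qed

lemma pos_def_matrix_inv_psd:
  fixes M :: "real^'n^'n"
  assumes "pos_def_matrix M"
  shows "0 \<le> x \<bullet> (matrix_inv M *v x)"
proof -
  have "x \<bullet> (matrix_inv M *v x) = (matrix_invsqrt M *v x) \<bullet> (matrix_invsqrt M *v x)"
    unfolding matrix_invsqrt_mult_self[OF assms, symmetric] matrix_vector_mul_assoc[symmetric]
    by (subst inner_matrix_vector_mult) (simp add: transpose_matrix_invsqrt[OF assms])
  then show ?thesis by simp
qed

text \<open>
  The whitened residual is \<open>W + u \<omega>\<close> with \<open>u = H\<^sup>-\<^sup>1\<^sup>/\<^sup>2 1\<close> orthogonal to the columns of \<open>W\<close>, and only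
  the row vector \<open>\<omega>\<close> depends on \<open>\<mu>\<close>.
\<close>

lemma
  fixes X :: "real^'p^'n" and F :: "real^'r^'n" and H Hc :: "real^'n^'n"
    and A :: "real^'d^'p" and B :: "real^'r^'d" and \<Delta> :: "real^'p^'p"
  assumes H: "pos_def_matrix H" and \<Delta>: "pos_def_matrix \<Delta>"
    and Hc: "Hc = mat 1 - inverse (vec 1 \<bullet> (matrix_inv H *v vec 1)) *\<^sub>R
               ((columnvector (vec 1) :: real^1^'n) ** rowvector (vec 1) ** matrix_inv H)"
    and W: "W = matrix_invsqrt H ** Hc ** (X - F ** transpose (A ** B))"
  defines "profile \<equiv> - (real CARD('n) * real CARD('p) / 2) * ln (2 * pi)
     - (real CARD('p) / 2) * ln (det H) - (real CARD('n) / 2) * ln (det \<Delta>)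
     - (1 / 2) * trace (matrix_inv \<Delta> ** (transpose W ** W))"
  shows sscm_loglik_le_profile: "sscm_loglik X F \<mu> A B \<Delta> H \<le> profile"
    and sscm_loglik_eq_profile:
      "\<mu> = inverse (vec 1 \<bullet> (matrix_inv H *v vec 1)) *\<^sub>R
           (((transpose X - A ** B ** transpose F) ** matrix_inv H) *v vec 1)
        \<Longrightarrow> sscm_loglik X F \<mu> A B \<Delta> H = profile"
proof -
  let ?K = "matrix_invsqrt H"
  note Ksym = transpose_matrix_invsqrt[OF H]
  note KK = matrix_invsqrt_mult_self[OF H, symmetric]
  define one :: "real^1^'n" where "one = columnvector (vec 1)"
  define c where "c = vec 1 \<bullet> (matrix_inv H *v (vec 1 :: real^'n))"
  define u where "u = ?K *v (vec 1 :: real^'n)"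
  define U where "U = ?K ** one"
  define Y where "Y = X - F ** transpose (A ** B)"
  \<comment> \<open>The first term is the transposed generalised least squares estimate of the mean
    for given \<open>A ** B\<close>, so \<open>\<omega>\<close> is the deviation of \<mu> from
    it.\<close>
  define \<omega> where "\<omega> = inverse c *\<^sub>R (transpose U ** ?K ** Y) - rowvector \<mu>"
  define R where "R = sscm_residual X F \<mu> A B"
  have Hc': "Hc = mat 1 - inverse c *\<^sub>R (one ** transpose one ** matrix_inv H)"
    unfolding Hc c_def one_def transpose_columnvector by (rule refl)
  have cu: "c = u \<bullet> u"
    unfolding c_def KK u_def matrix_vector_mul_assoc[symmetric]
    by (subst inner_matrix_vector_mult) (simp add: Ksym)
  have "u \<noteq> 0"
  proof
    assume "u = 0"
    then have "(matrix_sqrt H ** ?K) *v (vec 1 :: real^'n) = 0"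
      unfolding u_def matrix_vector_mul_assoc[symmetric] by simp
    then show False
      by (simp add: matrix_invsqrt_right[OF H] vec_eq_iff)
  qed
  then have c: "c > 0"
    by (simp add: cu)
  have U: "U = columnvector u"
    by (simp add: U_def u_def one_def dot_rowvector_columnvector)
  have UU: "transpose U ** U = c *\<^sub>R mat 1"
    by (simp add: U cu vec_eq_iff matrix_matrix_mult_def transpose_def columnvector_def inner_vec_def mat_def)
  \<comment> \<open>Centring by \<open>Hc\<close> becomes, after whitening, the orthogonal
    projection along \<open>u\<close>. Hence \<open>W\<close> is orthogonal to
    \<open>U\<close>.\<close>
  have KHc: "?K ** Hc = ?K - inverse c *\<^sub>R (U ** transpose U ** ?K)"
    by (simp add: Hc' matrix_distribs U_def matrix_transpose_mul Ksym KK matrix_mul_assoc)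
  have "transpose U ** (?K ** Hc)
      = transpose U ** ?K - inverse c *\<^sub>R ((transpose U ** U) ** (transpose U ** ?K))"
    by (simp add: KHc matrix_distribs matrix_mul_assoc)
  then have "transpose U ** (?K ** Hc) = 0"
    using c by (simp add: UU matrix_distribs)
  then have UW: "transpose U ** W = 0"
    by (simp add: W matrix_mul_assoc)
  then have WU: "transpose W ** U = 0"
    by (metis matrix_transpose_mul transpose_transpose transpose_0)
  have "R = Y - one ** rowvector \<mu>"
    by (simp add: R_def sscm_residual_def Y_def one_def matrix_transpose_mul matrix_mul_assoc
        algebra_simps)
  then have "?K ** R = ?K ** Y - U ** rowvector \<mu>"
    by (simp add: matrix_distribs U_def matrix_mul_assoc)
  moreover have "W = ?K ** Y - inverse c *\<^sub>R (U ** transpose U ** ?K ** Y)"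
    by (simp add: W KHc Y_def[symmetric] matrix_distribs)
  ultimately have KR: "?K ** R = W + U ** \<omega>"
    by (simp add: \<omega>_def matrix_distribs matrix_mul_assoc)
  have "transpose (?K ** R) ** (?K ** R) = transpose W ** W + (transpose W ** U) ** \<omega>
      + transpose \<omega> ** (transpose U ** W) + transpose \<omega> ** (transpose U ** U) ** \<omega>"
    by (simp add: KR transpose_distribs matrix_distribs matrix_mul_assoc)
  then have gram: "transpose (?K ** R) ** (?K ** R) = transpose W ** W + c *\<^sub>R (transpose \<omega> ** \<omega>)"
    by (simp add: UW WU UU matrix_distribs)
  have "trace (?K ** R ** matrix_inv \<Delta> ** transpose R ** ?K)
      = trace ((?K ** R) ** (matrix_inv \<Delta> ** transpose (?K ** R)))"
    by (simp add: matrix_transpose_mul Ksym matrix_mul_assoc)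
  also have "\<dots> = trace (matrix_inv \<Delta> ** (transpose (?K ** R) ** (?K ** R)))"
    by (subst trace_mul_sym) (simp add: matrix_mul_assoc)
  also have "\<dots> = trace (matrix_inv \<Delta> ** (transpose W ** W))
      + c * trace (matrix_inv \<Delta> ** (transpose \<omega> ** \<omega>))"
    by (simp add: gram matrix_distribs trace_add trace_scaleR)
  also have "trace (matrix_inv \<Delta> ** (transpose \<omega> ** \<omega>)) = trace (\<omega> ** matrix_inv \<Delta> ** transpose \<omega>)"
    using trace_mul_sym[of "matrix_inv \<Delta> ** transpose \<omega>" \<omega>] by (simp add: matrix_mul_assoc)
  finally have loglik: "sscm_loglik X F \<mu> A B \<Delta> H
      = profile - (c / 2) * trace (\<omega> ** matrix_inv \<Delta> ** transpose \<omega>)"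
    by (simp add: sscm_loglik_def profile_def R_def[symmetric] algebra_simps)
  have "0 \<le> c * trace (\<omega> ** matrix_inv \<Delta> ** transpose \<omega>)"
    using c by (intro mult_nonneg_nonneg trace_psd_congruence pos_def_matrix_inv_psd[OF \<Delta>]) simp
  then show "sscm_loglik X F \<mu> A B \<Delta> H \<le> profile"
    by (simp add: loglik)
  \<comment> \<open>This choice of \<mu> amounts to \<open>\<omega> = 0\<close>, so the nonnegative
    penalty in \<open>loglik\<close> vanishes.\<close>
  assume \<mu>: "\<mu> = inverse (vec 1 \<bullet> (matrix_inv H *v vec 1)) *\<^sub>R
           (((transpose X - A ** B ** transpose F) ** matrix_inv H) *v vec 1)"
  have "transpose X - A ** B ** transpose F = transpose Y"
    by (simp add: Y_def transpose_distribs matrix_mul_assoc)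
  then have "\<mu> = inverse c *\<^sub>R ((transpose Y ** matrix_inv H) *v vec 1)"
    by (simp add: \<mu> c_def)
  then have "columnvector \<mu> = inverse c *\<^sub>R (columnvector ((transpose Y ** matrix_inv H) *v vec 1) :: real^1^'p)"
    by (simp add: columnvector_def vec_eq_iff)
  then have "(columnvector \<mu> :: real^1^'p) = inverse c *\<^sub>R (transpose Y ** ?K ** U)"
    by (simp add: dot_rowvector_columnvector U_def KK one_def matrix_mul_assoc)
  then have "transpose (columnvector \<mu> :: real^1^'p) = inverse c *\<^sub>R (transpose U ** ?K ** Y)"
    by (simp add: transpose_distribs Ksym matrix_mul_assoc)
  then have "\<omega> = 0"
    by (simp add: \<omega>_def transpose_columnvector)
  then show "sscm_loglik X F \<mu> A B \<Delta> H = profile"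
    by (simp add: loglik trace_def)
qed

section \<open>Joint maximisation over mean, coefficient and covariance\<close>

lemma pos_def_matrix_add_psd:
  assumes "pos_def_matrix D" "transpose N = N" "\<And>x. 0 \<le> x \<bullet> (N *v x)"
  shows "pos_def_matrix (D + N)"
  using assms
  by (simp add: pos_def_matrix_def transpose_add matrix_vector_mult_add_rdistrib inner_add_right
      add_pos_nonneg)

lemma pos_def_matrix_psd:
  assumes "pos_def_matrix M"
  shows "0 \<le> x \<bullet> (M *v x)"
  using pos_def_matrixD(3)[OF assms, of x] by (cases "x = 0") (auto simp: less_imp_le)

theorem proposition3p1:
  fixes X :: "real^'p^'n" and Y :: "real^'n" and f :: "real \<Rightarrow> real^'r"
    and D :: "(real^2) set" and s :: "'n \<Rightarrow> real^2"
    and dst :: "real^2 \<Rightarrow> real" and \<rho> :: "real \<Rightarrow> real"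
    and F Fbar :: "real^'r^'n" and Xbar :: "real^'p^'n" and H Hc :: "real^'n^'n"
    and S_XF C_LS :: "real^'r^'p" and S_FX :: "real^'p^'r" and S_FF :: "real^'r^'r"
    and Delta_LS S :: "real^'p^'p"
    and lam :: "nat \<Rightarrow> real" and v :: "nat \<Rightarrow> real^'p" and col :: "'d::finite \<Rightarrow> nat"
    and V A_hat :: "real^('d::finite)^'p" and B_hat :: "real^'r^('d::finite)"
    and mu_hat :: "real^'p" and Delta_hat :: "real^'p^'p"
  assumes "CARD('d::finite) \<le> CARD('p)"
    and "F = (\<chi> i. f (Y $ i))"
    and "range s \<subseteq> D" and "Metric_space D (\<lambda>x y. dst (x - y))" and "\<forall>t\<ge>0. 0 \<le> \<rho> t"
    and "H = (\<chi> i j. \<rho> (dst (s i - s j)))" and "pos_def_matrix H"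
    and "Hc = mat 1 - inverse (vec 1 \<bullet> (matrix_inv H *v vec 1)) *\<^sub>R
               ((columnvector (vec 1) :: real^1^'n) ** rowvector (vec 1) ** matrix_inv H)"
    and "Xbar = matrix_invsqrt H ** Hc ** X"
    and "Fbar = matrix_invsqrt H ** Hc ** F"
    and "S_XF = (1 / real CARD('n)) *\<^sub>R (transpose Xbar ** Fbar)"
    and "S_FX = transpose S_XF"
    and "S_FF = (1 / real CARD('n)) *\<^sub>R (transpose Fbar ** Fbar)" and "invertible S_FF"
    and "C_LS = S_XF ** matrix_inv S_FF"
    and "Delta_LS = (1 / real CARD('n)) *\<^sub>R
           (transpose (Xbar - Fbar ** transpose C_LS) ** (Xbar - Fbar ** transpose C_LS))"
    and "invertible Delta_LS"
    and "S = matrix_invsqrt Delta_LS ** S_XF ** matrix_inv S_FF ** S_FX ** matrix_invsqrt Delta_LS"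
    and "ordered_eigenbasis S (\<lambda>j. (lam j)\<^sup>2) v"
    and "bij_betw col (UNIV :: 'd::finite set) {..<CARD('d)}"
    and "V = (\<chi> i k. v (col k) $ i)"
    and "A_hat = matrix_sqrt Delta_LS ** V"
    and "B_hat = transpose V ** matrix_invsqrt Delta_LS ** S_XF ** matrix_inv S_FF"
    and "mu_hat = inverse (vec 1 \<bullet> (matrix_inv H *v vec 1)) *\<^sub>R
           (((transpose X - A_hat ** B_hat ** transpose F) ** matrix_inv H) *v vec 1)"
    and "Delta_hat = (1 / real CARD('n)) *\<^sub>R
           ((transpose Xbar - A_hat ** B_hat ** transpose Fbar) **
             transpose (transpose Xbar - A_hat ** B_hat ** transpose Fbar))"
  shows "sscm_mle X F H mu_hat A_hat B_hat Delta_hat"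
proof -
  let ?n = "real CARD('n)" and ?d = "CARD('d)" and ?p = "CARD('p)"
  note d = assms(1) and H = assms(7) and Hc = assms(8) and Xbar = assms(9) and Fbar = assms(10)
    and S_XF = assms(11) and S_FX = assms(12) and S_FF = assms(13) and inv_FF = assms(14)
    and C_LS = assms(15) and Delta_LS = assms(16) and inv_D = assms(17) and S = assms(18)
    and eb = assms(19) and col = assms(20) and V = assms(21) and A_hat = assms(22)
    and B_hat = assms(23) and mu_hat = assms(24) and Delta_hat = assms(25)
  \<comment> \<open>\<open>W C\<close> is the whitened and centred residual for the coefficient
    \<open>C\<close>, and \<open>M C\<close> its empirical covariance, the best \<Delta> for this
    \<open>C\<close>.\<close>
  define W where "W C = Xbar - Fbar ** transpose C" for C
  define M where "M C = (1 / ?n) *\<^sub>R (transpose (W C) ** W C)" for C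
  have W: "W C = matrix_invsqrt H ** Hc ** (X - F ** transpose C)" for C
    by (simp add: W_def Xbar Fbar matrix_distribs matrix_mul_assoc)
  have D: "pos_def_matrix Delta_LS"
    using inv_D unfolding Delta_LS by (intro invertible_gram_pos_def) simp
  have G: "pos_def_matrix S_FF"
    using inv_FF unfolding S_FF by (intro invertible_gram_pos_def) simp
  note Gsym = pos_def_matrixD(1)[OF G] and Gpsd = pos_def_matrix_psd[OF G]
  have M: "M C = Delta_LS + (C_LS - C) ** S_FF ** transpose (C_LS - C)" for C
    unfolding M_def W_def
    by (rule least_squares_decomposition[OF S_XF S_FF inv_FF _ C_LS Delta_LS]) simp
  have pdM: "pos_def_matrix (M C)" for C
    unfolding M by (rule pos_def_matrix_add_psd[OF D]) 
      (simp_all add: matrix_transpose_mul Gsym matrix_mul_assoc psd_congruence[OF Gpsd])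
  \<comment> \<open>Both covariance factors of \<open>S\<close> are expressed through
    \<open>C_LS\<close>, which gives the sandwich form required for the reduced-rank bound.\<close>
  have "C_LS ** S_FF = S_XF"
    by (simp add: C_LS matrix_inv_left[OF inv_FF] flip: matrix_mul_assoc)
  moreover have "transpose C_LS = matrix_inv S_FF ** S_FX"
    by (simp add: C_LS S_FX matrix_transpose_mul transpose_matrix_inv[OF inv_FF] Gsym)
  ultimately have S': "S = matrix_invsqrt Delta_LS ** C_LS ** S_FF ** transpose C_LS
      ** matrix_invsqrt Delta_LS"
    by (simp add: S flip: matrix_mul_assoc)
  define bound where "bound = det Delta_LS * (\<Prod>j=?d..<?p. 1 + (lam j)\<^sup>2)"
  have M_ge: "bound \<le> det (M (A ** B))" for A :: "real^'d^'p" and B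
    unfolding M bound_def by (rule det_reduced_rank_ge[OF D Gsym Gpsd S' eb _ d]) simp
  have B_hat': "B_hat = transpose V ** matrix_invsqrt Delta_LS ** C_LS"
    by (simp add: B_hat C_LS matrix_mul_assoc)
  have M_hat: "det (M (A_hat ** B_hat)) = bound"
    unfolding M bound_def
    by (rule det_reduced_rank_eq[OF D Gsym Gpsd S' eb _ d col V A_hat B_hat']) simp
  \<comment> \<open>Needed for the monotonicity of \<open>ln\<close>; at the estimate
    \<open>bound\<close> is the determinant of a positive definite matrix.\<close>
  have bound_pos: "0 < bound"
    using pos_def_det_pos[OF pdM] M_hat by metis
  have Delta_hat': "Delta_hat = M (A_hat ** B_hat)"
    by (simp add: Delta_hat M_def W_def transpose_distribs matrix_mul_assoc)
  define const where "const = - (?n * real ?p / 2) * ln (2 * pi) - (real ?p / 2) * ln (det H)"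
  have trace_M: "trace (\<Delta> ** (transpose (W C) ** W C)) = ?n * trace (\<Delta> ** M C)" for \<Delta> C
    by (simp add: M_def matrix_distribs trace_scaleR)
  \<comment> \<open>Three bounds are chained: over \<mu> by the profile, over \<Delta> by
    \<open>ln_det_le_trace\<close>, over \<open>A ** B\<close> by \<open>bound\<close>.\<close>
  have "sscm_loglik X F \<mu> A B \<Delta> H \<le> const - (?n / 2) * (ln bound + real ?p)"
    if \<Delta>: "pos_def_matrix \<Delta>" for \<mu> and A :: "real^'d^'p" and B \<Delta>
  proof -
    have "ln bound + real ?p \<le> ln (det (M (A ** B))) + real ?p"
      using M_ge[of A B] bound_pos by simp
    also have "\<dots> \<le> ln (det \<Delta>) + trace (matrix_inv \<Delta> ** M (A ** B))"
      by (rule ln_det_le_trace[OF \<Delta> pdM])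
    finally have le: "ln bound + real ?p \<le> ln (det \<Delta>) + trace (matrix_inv \<Delta> ** M (A ** B))" .
    have "sscm_loglik X F \<mu> A B \<Delta> H
        \<le> const - (?n / 2) * (ln (det \<Delta>) + trace (matrix_inv \<Delta> ** M (A ** B)))"
      using sscm_loglik_le_profile[OF H \<Delta> Hc W, of \<mu> A B]
      by (simp add: const_def trace_M algebra_simps)
    also have "\<dots> \<le> const - (?n / 2) * (ln bound + real ?p)"
      by (intro diff_left_mono mult_left_mono le) simp
    finally show ?thesis .
  qed
  \<comment> \<open>At \<open>Delta_hat\<close> the matrix \<open>M\<close> meets its own inverse,
    so the trace is \<open>p\<close>; all three bounds become equalities.\<close>
  moreover have "sscm_loglik X F mu_hat A_hat B_hat Delta_hat H = const - (?n / 2) * (ln bound + real ?p)"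
    unfolding Delta_hat' sscm_loglik_eq_profile[OF H pdM Hc W mu_hat] trace_M M_hat
    using matrix_inv_left[OF pos_def_matrixD(2)[OF pdM[of "A_hat ** B_hat"]]]
    by (simp add: const_def trace_I algebra_simps)
  ultimately show ?thesis
    using pdM by (simp add: sscm_mle_def Delta_hat')
qed

end
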